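(* If $T$ is a tree with at least two vertices, then $\mathrm{def}_c(\widetilde{T})\ge |F(T)|-M(T)-2$.
   Context: All graphs are finite, simple and undirected. Let $T$ be a tree with $V(T)=\{v_1,\dots,v_n\}$, $n\ge2$, and let $F(T)$ be the set of vertices of degree $1$ in $T$. For $i\ne j$, let $P(v_i,v_j)$ be the unique path in $T$ between $v_i$ and $v_j$, with vertex set $VP(v_i,v_j)$ and edge set $EP(v_i,v_j)$, and set $LP(v_i,v_j)=|EP(v_i,v_j)|+|\{vw\in E(T): v\in VP(v_i,v_j),\ w\notin VP(v_i,v_j)\}|$ and $M(T)=\max_{1\le i<j\le n}LP(v_i,v_j)$. The graph $\widetilde{T}$ is obtained from $T$ by adding a new vertex $u$ and joining $u$ to every vertex of $F(T)$. A set $A\subseteq\{1,\dots,t\}$ is a cyclic interval modulo $t$ if $A$ or $\{1,\dots,t\}\setminus A$ is an interval of integers; a cyclic interval $t$-coloring is a proper edge coloring with colors $1,\dots,t$ in which the set of colors at every vertex is a cyclic interval modulo $t$. The cyclic deficiency $\mathrm{def}_c(H)$ of a graph $H$ is the minimum number of pendant edges whose attachment to $H$ yields a graph admitting a cyclic interval coloring. *)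

theory Defs
  imports Main
begin

datatype 'a graph = Graph (verts: "'a set") (edges: "'a set set")

definition simple_graph :: "'a graph \<Rightarrow> bool" where
  "simple_graph G \<longleftrightarrow> finite (verts G) \<and> (\<forall>e\<in>edges G. e \<subseteq> verts G \<and> card e = 2)"

definition incident :: "'a graph \<Rightarrow> 'a \<Rightarrow> 'a set set" where
  "incident G v = {e \<in> edges G. v \<in> e}"

definition vertex_degree :: "'a graph \<Rightarrow> 'a \<Rightarrow> nat" where
  "vertex_degree G v = card (incident G v)"

definition is_path :: "'a graph \<Rightarrow> 'a list \<Rightarrow> bool" where
  "is_path G p \<longleftrightarrow> p \<noteq> [] \<and> distinct p \<and> set p \<subseteq> verts G \<and>
     successively (\<lambda>x y. {x, y} \<in> edges G) p"

definition path_between :: "'a graph \<Rightarrow> 'a \<Rightarrow> 'a \<Rightarrow> 'a list \<Rightarrow> bool" where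
  "path_between G v w p \<longleftrightarrow> is_path G p \<and> hd p = v \<and> last p = w"

definition path_edges :: "'a list \<Rightarrow> 'a set set" where
  "path_edges p = {{p ! i, p ! Suc i} | i. Suc i < length p}"

definition connected_graph :: "'a graph \<Rightarrow> bool" where
  "connected_graph G \<longleftrightarrow> verts G \<noteq> {} \<and>
     (\<forall>v\<in>verts G. \<forall>w\<in>verts G. \<exists>p. path_between G v w p)"

definition is_cycle :: "'a graph \<Rightarrow> 'a list \<Rightarrow> bool" where
  "is_cycle G p \<longleftrightarrow> is_path G p \<and> 3 \<le> length p \<and> {last p, hd p} \<in> edges G"

definition tree :: "'a graph \<Rightarrow> bool" where
  "tree G \<longleftrightarrow> simple_graph G \<and> connected_graph G \<and> (\<nexists>p. is_cycle G p)"

definition leaves :: "'a graph \<Rightarrow> 'a set" where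
  "leaves T = {v \<in> verts T. vertex_degree T v = 1}"

definition tree_path :: "'a graph \<Rightarrow> 'a \<Rightarrow> 'a \<Rightarrow> 'a list" where
  "tree_path T v w = (THE p. path_between T v w p)"

definition VP :: "'a graph \<Rightarrow> 'a \<Rightarrow> 'a \<Rightarrow> 'a set" where
  "VP T v w = set (tree_path T v w)"

definition EP :: "'a graph \<Rightarrow> 'a \<Rightarrow> 'a \<Rightarrow> 'a set set" where
  "EP T v w = path_edges (tree_path T v w)"

definition LP :: "'a graph \<Rightarrow> 'a \<Rightarrow> 'a \<Rightarrow> nat" where
  "LP T v w = card (EP T v w) +
     card {e \<in> edges T. \<exists>x y. e = {x, y} \<and> x \<in> VP T v w \<and> y \<notin> VP T v w}"

text \<open>Since \<open>LP T v w = LP T w v\<close> in a tree, the maximum over ordered pairs of distinct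
  vertices is the maximum over unordered pairs.\<close>

definition max_LP :: "'a graph \<Rightarrow> nat" where
  "max_LP T = Max {LP T v w | v w. v \<in> verts T \<and> w \<in> verts T \<and> v \<noteq> w}"

text \<open>\<open>None\<close> is the added vertex; \<open>Some v\<close> is the copy of the vertex \<open>v\<close> of \<open>T\<close>.\<close>

definition tilde :: "'a graph \<Rightarrow> 'a option graph" where
  "tilde T = Graph (insert None (Some ` verts T))
     ((\<lambda>e. Some ` e) ` edges T \<union> {{None, Some v} | v. v \<in> leaves T})"

definition proper_edge_coloring :: "'a graph \<Rightarrow> nat \<Rightarrow> ('a set \<Rightarrow> nat) \<Rightarrow> bool" where
  "proper_edge_coloring G t c \<longleftrightarrow> (\<forall>e\<in>edges G. c e \<in> {1..t}) \<and>
     (\<forall>e\<in>edges G. \<forall>f\<in>edges G. e \<noteq> f \<and> e \<inter> f \<noteq> {} \<longrightarrow> c e \<noteq> c f)"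

definition nat_interval :: "nat set \<Rightarrow> bool" where
  "nat_interval A \<longleftrightarrow> (\<exists>a b. A = {a..b})"

definition cyclic_interval :: "nat \<Rightarrow> nat set \<Rightarrow> bool" where
  "cyclic_interval t A \<longleftrightarrow> A \<subseteq> {1..t} \<and> (nat_interval A \<or> nat_interval ({1..t} - A))"

definition cyclic_interval_coloring :: "'a graph \<Rightarrow> nat \<Rightarrow> ('a set \<Rightarrow> nat) \<Rightarrow> bool" where
  "cyclic_interval_coloring G t c \<longleftrightarrow> proper_edge_coloring G t c \<and>
     (\<forall>v\<in>verts G. cyclic_interval t (c ` incident G v))"

definition cyclically_interval_colorable :: "'a graph \<Rightarrow> bool" where
  "cyclically_interval_colorable G \<longleftrightarrow> (\<exists>t c. cyclic_interval_coloring G t c)"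

text \<open>Attaches \<open>p v\<close> pendant edges at every vertex \<open>v\<close> of \<open>H\<close>: \<open>Inl v\<close> is the copy of
  \<open>v\<close>, and \<open>Inr (v, i)\<close> is the new degree-one end of the \<open>i\<close>-th pendant edge at \<open>v\<close>.\<close>

definition attach_pendant :: "'a graph \<Rightarrow> ('a \<Rightarrow> nat) \<Rightarrow> ('a + 'a \<times> nat) graph" where
  "attach_pendant H p =
     Graph (Inl ` verts H \<union> {Inr (v, i) | v i. v \<in> verts H \<and> i < p v})
       ((\<lambda>e. Inl ` e) ` edges H \<union> {{Inl v, Inr (v, i)} | v i. v \<in> verts H \<and> i < p v})"

definition cyclic_deficiency :: "'a graph \<Rightarrow> nat" where
  "cyclic_deficiency H = (LEAST k. \<exists>p. (\<Sum>v\<in>verts H. p v) = k \<and>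
     cyclically_interval_colorable (attach_pendant H p))"

text \<open>The minimum is over a nonempty set: colour the edges injectively and add all missing
  colours at every vertex.\<close>

lemma attach_pendant_colorable_exists:
  assumes G: "simple_graph (H :: 'a graph)"
  shows "\<exists>p. cyclically_interval_colorable (attach_pendant H p)"
proof -
  have sub: "e \<subseteq> verts H" if "e \<in> edges H" for e
    using G that by (auto simp: simple_graph_def)
  have "finite (edges H)"
    using G sub by (metis Pow_iff finite_Pow_iff finite_subset simple_graph_def subsetI)
  then obtain h where h: "bij_betw h (edges H) {0..<card (edges H)}"
    using ex_bij_betw_finite_nat by blast
  define m where "m = card (edges H)"
  define c0 where "c0 e = Suc (h e)" for e
  have inj: "inj_on c0 (edges H)"
    using h by (auto simp: c0_def bij_betw_def inj_on_def)
  have rng: "c0 e \<in> {1..m}" if "e \<in> edges H" for e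
    using bij_betwE[OF h] that by (auto simp: c0_def m_def Suc_le_eq)
  define S where "S v = {1..m} - c0 ` incident H v" for v
  have "\<exists>g. bij_betw g {0..<card (S v)} (S v)" for v
    by (rule ex_bij_betw_nat_finite) (simp add: S_def)
  then obtain g where g: "\<And>v. bij_betw (g v) {0..<card (S v)} (S v)"
    by metis
  define p where "p v = card (S v)" for v
  define c :: "('a + 'a \<times> nat) set \<Rightarrow> nat" where
    "c e = (if \<exists>x. Inr x \<in> e then (case (THE x. Inr x \<in> e) of (v, i) \<Rightarrow> g v i)
      else c0 (Inl -` e))" for e
  have c_old: "c (Inl ` e) = c0 e" for e
  proof -
    have "Inl -` (Inl ` e :: ('a + 'a \<times> nat) set) = e" by auto
    then show ?thesis by (auto simp: c_def)
  qed
  have c_new: "c {Inl v, Inr (v, i)} = g v i" for v i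
    by (auto simp: c_def)
  have gS: "g v i \<in> S v" if "i < p v" for v i
    using bij_betwE[OF g[of v]] that by (auto simp: p_def)
  have gI: "i = j" if "g v i = g v j" "i < p v" "j < p v" for v i j
    using bij_betw_imp_inj_on[OF g[of v]] that by (auto simp: p_def inj_on_def)
  have gimg: "g v ` {i. i < p v} = S v" for v
    using bij_betw_imp_surj_on[OF g[of v]] by (simp add: p_def atLeast0LessThan lessThan_def)
  let ?A = "attach_pendant H p"
  have "proper_edge_coloring ?A m c"
    unfolding proper_edge_coloring_def
  proof (intro conjI ballI impI)
    fix e assume "e \<in> edges ?A"
    then show "c e \<in> {1..m}"
      using rng gS by (fastforce simp: attach_pendant_def c_old c_new S_def)
  next
    fix e f assume e: "e \<in> edges ?A" and f: "f \<in> edges ?A" and ef: "e \<noteq> f \<and> e \<inter> f \<noteq> {}"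
    have mixed: "c0 x \<noteq> g v i" if "x \<in> edges H" "v \<in> x" "i < p v" for x v i
      using gS[OF that(3)] that unfolding S_def incident_def by (metis (mono_tags, lifting) DiffD2 imageI mem_Collect_eq)
    consider (oo) x y where "x \<in> edges H" "y \<in> edges H" "e = Inl ` x" "f = Inl ` y"
      | (on) x v i where "x \<in> edges H" "i < p v" "e = Inl ` x" "f = {Inl v, Inr (v, i)}"
      | (no) x v i where "x \<in> edges H" "i < p v" "f = Inl ` x" "e = {Inl v, Inr (v, i)}"
      | (nn) v i w j where "i < p v" "j < p w" "e = {Inl v, Inr (v, i)}" "f = {Inl w, Inr (w, j)}"
      using e f unfolding attach_pendant_def by auto
    then show "c e \<noteq> c f"
    proof cases
      case oo
      then show ?thesis using inj ef by (auto simp: c_old dest: inj_onD)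
    next
      case on
      then have "v \<in> x" using ef by auto
      then show ?thesis using on mixed by (simp add: c_old c_new)
    next
      case no
      then have "v \<in> x" using ef by auto
      then show ?thesis using no mixed by (metis c_old c_new)
    next
      case nn
      then have "v = w" using ef by auto
      then show ?thesis using nn ef gI by (auto simp: c_new)
    qed
  qed
  moreover have "cyclic_interval m (c ` incident ?A z)" if "z \<in> verts ?A" for z
  proof (cases z)
    case (Inl v)
    then have v: "v \<in> verts H" using that by (auto simp: attach_pendant_def)
    have "incident ?A z =
        (\<lambda>e. Inl ` e) ` incident H v \<union> (\<lambda>i. {Inl v, Inr (v, i)}) ` {i. i < p v}"
      using v Inl by (auto simp: incident_def attach_pendant_def)
    then have "c ` incident ?A z = c0 ` incident H v \<union> g v ` {i. i < p v}"
      by (simp add: image_Un image_image c_old c_new)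
    also have "\<dots> = {1..m}"
      using rng unfolding gimg S_def by (auto simp: incident_def)
    finally show ?thesis by (auto simp: cyclic_interval_def nat_interval_def)
  next
    case (Inr y)
    obtain v i where y: "y = (v, i)" by (cases y)
    then have vi: "v \<in> verts H" "i < p v" using that Inr by (auto simp: attach_pendant_def)
    have "incident ?A z = {{Inl v, Inr (v, i)}}"
      using vi Inr y by (auto simp: incident_def attach_pendant_def)
    then have "c ` incident ?A z = {g v i .. g v i}" by (simp add: c_new)
    moreover have "g v i \<in> {1..m}" using gS[OF vi(2)] by (simp add: S_def)
    ultimately show ?thesis unfolding cyclic_interval_def nat_interval_def by force
  qed
  ultimately show ?thesis
    unfolding cyclically_interval_colorable_def cyclic_interval_coloring_def by blast
qed

end

theory Submission
  imports Defs
begin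

text \<open>Split the added vertex into one new end per leaf of \<open>T\<close>.  What remains is a tree, so
  the colours modulo \<open>t\<close> can be lifted to integers such that the colours at every
  vertex of \<open>T\<close> lie in an interval no longer than its degree: the shifts that glue the local
  lifts together form a potential on \<open>T\<close>.  The edges at the added vertex have different colours
  modulo \<open>t\<close>, so their lifts are \<open>|F(T)|\<close> different integers and two of them differ by
  at least \<open>|F(T)| - 1\<close>.  Walking along the tree path between the two corresponding
  leaves, the lift changes at each vertex by less than its degree, hence by at most
  \<open>LP + 1\<close> in total, plus the number of attached pendant edges.\<close>

section \<open>Paths in trees\<close>

lemma tree_simple: "tree G \<Longrightarrow> simple_graph G"
  by (simp add: tree_def)

lemma simple_graph_finite_edges: "simple_graph G \<Longrightarrow> finite (edges G)"
  unfolding simple_graph_def by (metis Pow_iff finite_Pow_iff finite_subset subsetI)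

lemma simple_graph_edgeD:
  assumes "simple_graph G" "{x, y} \<in> edges G"
  shows "x \<in> verts G" "y \<in> verts G" "x \<noteq> y"
proof -
  have "{x, y} \<subseteq> verts G" "card {x, y} = 2"
    using assms unfolding simple_graph_def by blast+
  then show "x \<in> verts G" "y \<in> verts G" "x \<noteq> y" by auto
qed

text \<open>Induction on the first path. If the two paths leave \<open>v\<close> by different edges,
  follow the first one until it meets the second: the two stretches up to the meeting point close up
  to a cycle through \<open>v\<close>.\<close>

lemma acyclic_path_unique:
  assumes "\<nexists>p. is_cycle G p" "path_between G v w p" "path_between G v w q"
  shows "p = q"
  using assms(2,3)
proof (induction p arbitrary: v q)
  case Nil
  then show ?case by (simp add: path_between_def is_path_def)
next
  case (Cons a p)
  have a: "a = v" using Cons.prems(1) by (simp add: path_between_def)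
  obtain q' where q: "q = v # q'"
    using Cons.prems(2) by (cases q) (auto simp: path_between_def is_path_def)
  consider "p = [] \<or> q' = []" | "p \<noteq> []" "q' \<noteq> []" by blast
  then show ?case
  proof cases
    case 1
    then show ?thesis
      using Cons.prems a q by (auto simp: path_between_def is_path_def split: if_splits)
  next
    case 2
    have p_path: "path_between G (hd p) w p" and q_path: "path_between G (hd q') w q'"
      and edges: "{v, hd p} \<in> edges G" "{v, hd q'} \<in> edges G"
      and fresh: "v \<notin> set p" "v \<notin> set q'" "v \<in> verts G"
      using Cons.prems 2 a q by (auto simp: path_between_def is_path_def successively_Cons)
    show ?thesis
    proof (cases "hd p = hd q'")
      case True
      then show ?thesis using Cons.IH[OF p_path] q_path a q by simp
    next
      case False
      have "w \<in> set p \<and> w \<in> set q'"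
        using p_path q_path 2 unfolding path_between_def by (metis last_in_set)
      then have "\<exists>x\<in>set p. x \<in> set q'" by blast
      \<comment> \<open>\<open>z\<close> is the first vertex of \<open>p\<close> on
        \<open>q'\<close>, so that \<open>A\<close> and \<open>C\<close> are disjoint and the closed
        walk below repeats no vertex.\<close>
      then obtain A z B where p_split: "p = A @ z # B" and z: "z \<in> set q'"
        and A: "\<forall>x\<in>set A. x \<notin> set q'"
        using split_list_first_prop[of p "\<lambda>x. x \<in> set q'"] by blast
      obtain C D where q_split: "q' = C @ z # D" using z by (meson split_list)
      let ?c = "v # A @ z # rev C"
      \<comment> \<open>If both were empty, both paths would continue from \<open>v\<close> to
        \<open>z\<close>; so the cycle has at least three vertices.\<close>
      have "A \<noteq> [] \<or> C \<noteq> []" using False p_split q_split by auto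
      then have "3 \<le> length ?c" by (cases A; cases C) auto
      moreover have "{last ?c, hd ?c} \<in> edges G"
        using edges(2) q_split by (cases C) (auto simp: insert_commute)
      moreover have "is_path G ?c"
      proof -
        let ?R = "\<lambda>x y. {x, y} \<in> edges G"
        have sym: "successively ?R (rev xs) = successively ?R xs" for xs
          by (simp add: insert_commute)
        have "successively ?R (v # A @ z # B)" "successively ?R (C @ z # D)"
          using p_path q_path edges(1)
          by (simp_all add: p_split q_split is_path_def path_between_def successively_Cons)
        then have "successively ?R (v # A @ [z])" "successively ?R (rev (C @ [z]))"
          unfolding sym by (auto simp: successively_append_iff successively_Cons hd_append)
        then have "successively ?R ?c"
          by (auto simp: successively_append_iff successively_Cons hd_append)
        moreover have "distinct ?c" "set ?c \<subseteq> verts G"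
          using p_path q_path fresh A
          by (auto simp: p_split q_split is_path_def path_between_def)
        ultimately show ?thesis by (simp add: is_path_def)
      qed
      ultimately show ?thesis using assms(1) unfolding is_cycle_def by blast
    qed
  qed
qed

lemma tree_path_between:
  assumes "tree G" "v \<in> verts G" "w \<in> verts G"
  shows "path_between G v w (tree_path G v w)"
proof -
  obtain p where p: "path_between G v w p"
    using assms unfolding tree_def connected_graph_def by blast
  show ?thesis
    unfolding tree_path_def
    by (rule theI[where P = "path_between G v w"], rule p) (use assms p in \<open>auto simp: tree_def intro: acyclic_path_unique\<close>)
qed

lemma tree_path_eqI:
  assumes "tree G" "path_between G v w p"
  shows "tree_path G v w = p"
  unfolding tree_path_def
  by (rule the_equality, rule assms(2)) (use assms in \<open>auto simp: tree_def intro: acyclic_path_unique\<close>)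

text \<open>If \<open>j\<close> exceeded \<open>i + 1\<close>, the segment from position
  \<open>i\<close> to position \<open>j\<close> would have at least three vertices and the edge
  would close it to a cycle.\<close>

lemma acyclic_path_no_chord:
  assumes acyc: "\<nexists>p. is_cycle G p" and p: "is_path G p"
    and ij: "i < j" "j < length p" and e: "{p ! i, p ! j} \<in> edges G"
  shows "j = Suc i"
proof (rule ccontr)
  assume "j \<noteq> Suc i"
  let ?q = "drop i (take (Suc j) p)"
  have len: "length ?q = Suc j - i" using ij by simp
  have "3 \<le> length ?q" using len ij \<open>j \<noteq> Suc i\<close> by simp
  moreover have "hd ?q = p ! i" using ij by (simp add: hd_drop_conv_nth)
  moreover have "last ?q = p ! j" using ij by (simp add: last_conv_nth)
  moreover have "is_path G ?q"
    using p ij set_drop_subset[of i "take (Suc j) p"] set_take_subset[of "Suc j" p]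
    by (auto simp: is_path_def successively_conv_nth)
  ultimately show False using acyc e by (metis is_cycle_def insert_commute)
qed

text \<open>If \<open>y\<close> is off the path to \<open>x\<close>, appending \<open>y\<close>
  gives a path. Otherwise the edge from \<open>y\<close> to \<open>x\<close> must not be a chord, so
  \<open>y\<close> comes just before \<open>x\<close> and deleting \<open>x\<close> leaves the path
  to \<open>y\<close>.\<close>

lemma tree_path_adjacent:
  assumes G: "tree G" and r: "r \<in> verts G" and e: "{x, y} \<in> edges G"
  shows "tree_path G r y = tree_path G r x @ [y] \<or> tree_path G r x = tree_path G r y @ [x]"
proof -
  note xy = simple_graph_edgeD[OF tree_simple[OF G] e]
  let ?p = "tree_path G r x"
  have p: "path_between G r x ?p" by (rule tree_path_between[OF G r xy(1)])
  show ?thesis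
  proof (cases "y \<in> set ?p")
    case False
    have "path_between G r y (?p @ [y])"
      using p False e xy
      by (auto simp: path_between_def is_path_def successively_append_iff)
    then show ?thesis using tree_path_eqI[OF G] by blast
  next
    case True
    then obtain j where j: "j < length ?p" "?p ! j = y" by (meson in_set_conv_nth)
    have ne: "?p \<noteq> []" using True by auto
    let ?l = "length ?p - 1"
    have l: "?p ! ?l = x" using p ne by (simp add: path_between_def last_conv_nth)
    have "j \<noteq> ?l" using l j xy by auto
    then have "j < ?l" using j by simp
    have "{?p ! j, ?p ! ?l} \<in> edges G" using e j l by (simp add: insert_commute)
    then have "?l = Suc j"
      using acyclic_path_no_chord[of G ?p j ?l] G p \<open>j < ?l\<close> by (auto simp: tree_def path_between_def)
    then have "butlast ?p = take (Suc j) ?p" by (simp add: butlast_conv_take)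
    moreover have "last ?p = x" using p by (simp add: path_between_def)
    ultimately have split: "take (Suc j) ?p @ [x] = ?p"
      using append_butlast_last_id[OF ne] by simp
    have "last (take (Suc j) ?p) = y" using j by (simp add: take_Suc_conv_app_nth)
    moreover have "is_path G (take (Suc j) ?p)" "hd (take (Suc j) ?p) = r"
      using p ne set_take_subset[of "Suc j" ?p] by (auto simp: path_between_def is_path_def successively_conv_nth)
    ultimately have "tree_path G r y = take (Suc j) ?p"
      by (intro tree_path_eqI[OF G]) (simp add: path_between_def)
    then show ?thesis using split by simp
  qed
qed

section \<open>Potentials on trees\<close>

text \<open>Fix a root and let \<open>h x\<close> be the sum of \<open>w\<close> along the tree path
  to \<open>x\<close>. The root paths of two adjacent vertices differ by just that edge, and
  antisymmetry of \<open>w\<close> covers both orders.\<close>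

lemma tree_potential:
  fixes w :: "'a \<Rightarrow> 'a \<Rightarrow> 'b :: ab_group_add"
  assumes G: "tree G" and anti: "\<And>x y. {x, y} \<in> edges G \<Longrightarrow> w y x = - w x y"
  obtains h where "\<And>x y. {x, y} \<in> edges G \<Longrightarrow> h y - h x = w x y"
proof -
  obtain r where r: "r \<in> verts G"
    using G by (auto simp: tree_def connected_graph_def)
  define S where "S p = (\<Sum>i<length p - 1. w (p ! i) (p ! Suc i))" for p
  have S: "S (p @ [y]) = S p + w (last p) y" if p: "p \<noteq> []" for p y
  proof -
    obtain n where n: "length p = Suc n" using p by (cases "length p") auto
    show ?thesis
      using p by (simp add: S_def n last_conv_nth nth_append)
  qed
  define h where "h x = S (tree_path G r x)" for x
  have step: "h y - h x = w x y"
    if e: "{x, y} \<in> edges G" and eq: "tree_path G r y = tree_path G r x @ [y]" for x y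
  proof -
    have "path_between G r x (tree_path G r x)"
      using tree_path_between[OF G r] simple_graph_edgeD[OF tree_simple[OF G] e] by blast
    then show ?thesis
      unfolding h_def eq by (subst S) (auto simp: path_between_def is_path_def)
  qed
  have "h y - h x = w x y" if e: "{x, y} \<in> edges G" for x y
    using tree_path_adjacent[OF G r e]
  proof
    assume "tree_path G r y = tree_path G r x @ [y]"
    then show ?thesis by (rule step[OF e])
  next
    assume "tree_path G r x = tree_path G r y @ [x]"
    then have "h x - h y = w y x" using step[of y x] e by (simp add: insert_commute)
    then show ?thesis using anti[OF e] by (metis minus_diff_eq minus_minus)
  qed
  then show ?thesis by (rule that)
qed

section \<open>Edges and degrees along a path\<close>

lemma path_edges_image: "path_edges p = (\<lambda>i. {p ! i, p ! Suc i}) ` {..<length p - 1}"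
  by (auto simp: path_edges_def)

lemma card_path_edges:
  assumes "p \<noteq> []"
  shows "card (path_edges p) < length p"
proof -
  have "card (path_edges p) \<le> length p - 1"
    using card_image_le[of "{..<length p - 1}" "\<lambda>i. {p ! i, p ! Suc i}"]
    by (simp add: path_edges_image)
  then show ?thesis using assms by (cases p) auto
qed

text \<open>An edge between two vertices of the path that is not a path edge would be a
  chord.\<close>

lemma acyclic_induced_path_edges:
  assumes G: "tree G" and p: "is_path G p" and e: "e \<in> edges G" "e \<subseteq> set p"
  shows "e \<in> path_edges p"
proof -
  have "card e = 2" using G e by (auto simp: tree_def simple_graph_def)
  then obtain x y where xy: "e = {x, y}" "x \<noteq> y" by (auto simp: card_2_iff)
  then obtain i j where ij: "i < length p" "j < length p" "x = p ! i" "y = p ! j"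
    using e by (metis in_set_conv_nth insert_subset)
  have *: "{p ! k, p ! l} \<in> path_edges p"
    if "k < l" "l < length p" "{p ! k, p ! l} \<in> edges G" for k l
    using acyclic_path_no_chord[OF _ p that] G that by (auto simp: tree_def path_edges_def)
  consider "i < j" | "j < i" using xy ij by (metis nat_neq_iff)
  then show ?thesis
    using *[of i j] *[of j i] e xy ij by cases (auto simp: insert_commute)
qed

text \<open>Double counting of incidences: an edge inside the path's vertex set counts twice, an
  edge leaving it once. The inner edges are path edges, so one copy of them and the leaving edges
  give at most \<open>LP\<close>, while the other copy is smaller than the number of path vertices.
  Thus \<open>vertex_degree G x - 1\<close> sums to at most \<open>LP G v w - 1\<close>.\<close>

lemma sum_degree_VP:
  assumes G: "tree G" and v: "v \<in> verts G" and w: "w \<in> verts G"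
  shows "(\<Sum>x\<in>VP G v w. vertex_degree G x) + 1 \<le> LP G v w + card (VP G v w)"
proof -
  let ?S = "VP G v w" and ?p = "tree_path G v w"
  let ?I = "{e \<in> edges G. e \<subseteq> ?S}"
  let ?O = "{e \<in> edges G. \<exists>x y. e = {x, y} \<and> x \<in> ?S \<and> y \<notin> ?S}"
  have p: "is_path G ?p"
    using tree_path_between[OF G v w] by (simp add: path_between_def)
  have finE: "finite (edges G)" by (rule simple_graph_finite_edges[OF tree_simple[OF G]])
  have finS: "finite ?S" by (simp add: VP_def)
  have card_meet: "card (e \<inter> ?S) = 2 * of_bool (e \<in> ?I) + of_bool (e \<in> ?O)"
    if e: "e \<in> edges G" for e
  proof -
    have "card e = 2" using G e by (auto simp: tree_def simple_graph_def)
    then obtain x y where xy: "e = {x, y}" "x \<noteq> y" by (auto simp: card_2_iff)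
    show ?thesis
      using e xy by (cases "x \<in> ?S"; cases "y \<in> ?S") (auto simp: doubleton_eq_iff)
  qed
  have "(\<Sum>x\<in>?S. vertex_degree G x) = (\<Sum>x\<in>?S. \<Sum>e\<in>edges G. of_bool (x \<in> e))"
    using finE by (simp add: vertex_degree_def incident_def sum.inter_filter[symmetric] of_bool_def)
  also have "\<dots> = (\<Sum>e\<in>edges G. \<Sum>x\<in>?S. of_bool (x \<in> e))"
    by (rule sum.swap)
  also have "\<dots> = (\<Sum>e\<in>edges G. card (e \<inter> ?S))"
    using finS by (intro sum.cong) (auto simp: of_bool_def sum.inter_filter[symmetric] Int_def conj_commute)
  also have "\<dots> = (\<Sum>e\<in>edges G. 2 * of_bool (e \<in> ?I) + of_bool (e \<in> ?O))"
    by (intro sum.cong refl card_meet)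
  also have "\<dots> = 2 * card ?I + card ?O"
  proof -
    have "(\<Sum>e\<in>edges G. of_bool (e \<in> A) :: nat) = card A" if "A \<subseteq> edges G" for A
      using finE that by (simp add: of_bool_def sum.inter_filter[symmetric] Int_absorb1 flip: Int_def)
    from this[of ?I] this[of ?O] show ?thesis
      by (simp add: sum.distrib sum_distrib_left[symmetric])
  qed
  finally have deg: "(\<Sum>x\<in>?S. vertex_degree G x) = 2 * card ?I + card ?O" .
  have "finite (EP G v w)" by (simp add: EP_def path_edges_image)
  then have "card ?I \<le> card (EP G v w)"
    using acyclic_induced_path_edges[OF G p] by (intro card_mono) (auto simp: EP_def VP_def)
  moreover have "card (EP G v w) < card ?S"
    using card_path_edges[of ?p] p by (simp add: EP_def VP_def is_path_def distinct_card)
  ultimately show ?thesis unfolding deg by (simp add: LP_def)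
qed

text \<open>An inner vertex of a path lies on two different path edges and so has degree at least
  two.\<close>

lemma leaf_in_path:
  assumes p: "is_path G p" and x: "x \<in> set p" "x \<in> leaves G"
  shows "x = hd p \<or> x = last p"
proof (rule ccontr)
  assume neg: "\<not> ?thesis"
  obtain i where i: "i < length p" "p ! i = x" using x by (meson in_set_conv_nth)
  have ne: "p \<noteq> []" using x by auto
  have "i \<noteq> 0" using neg i ne by (metis hd_conv_nth)
  then obtain k where k: "i = Suc k" by (cases i) auto
  have "Suc i \<noteq> length p" using neg i ne by (metis diff_Suc_1 last_conv_nth)
  then have Si: "Suc i < length p" using i by simp
  have "{p ! k, x} \<in> incident G x" "{x, p ! Suc i} \<in> incident G x"
    using p i k Si by (auto simp: is_path_def successively_conv_nth incident_def)
  moreover have "card (incident G x) = 1" using x by (simp add: leaves_def vertex_degree_def)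
  ultimately have "{p ! k, x} = {x, p ! Suc i}" by (metis card_1_singletonE singletonD)
  then have "p ! k = p ! Suc i" by (auto simp: doubleton_eq_iff)
  then show False using p k Si by (simp add: is_path_def nth_eq_iff_index_eq)
qed

section \<open>Integer lifts of cyclic intervals\<close>

text \<open>An interval is its own lift. If the complement is \<open>{a..b}\<close>, the colours
  above \<open>b\<close> stay and those below \<open>a\<close> are raised by \<open>t\<close>, which
  joins the two pieces into an interval starting at \<open>b + 1\<close>.\<close>

lemma cyclic_interval_lift:
  assumes "cyclic_interval t A"
  obtains s f where "\<And>a. a \<in> A \<Longrightarrow> int t dvd f a - int a"
    and "\<And>a. a \<in> A \<Longrightarrow> s \<le> f a" and "\<And>a. a \<in> A \<Longrightarrow> f a < s + int (card A)"
proof -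
  have A: "A \<subseteq> {1..t}" using assms by (simp add: cyclic_interval_def)
  note lift = that
  have interval: ?thesis if "A = {a..b}" for a b
    by (rule lift[where f = int and s = "int a"]) (auto simp: that)
  show ?thesis
  proof (cases "nat_interval A \<or> A = {1..t}")
    case True
    then show ?thesis using interval by (auto simp: nat_interval_def)
  next
    case False
    then obtain a b where ab: "{1..t} - A = {a..b}"
      using assms by (auto simp: cyclic_interval_def nat_interval_def)
    \<comment> \<open>An empty complement could be written with \<open>a > b\<close>; this is
      excluded because \<open>A\<close> is not all of \<open>{1..t}\<close>.\<close>
    have "{a..b} \<noteq> {}" using False A ab by blast
    then have le: "a \<le> b" by simp
    then have "a \<in> {1..t}" "b \<in> {1..t}" using ab by auto
    moreover have A_eq: "A = {1..t} - {a..b}" using ab A by blast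
    ultimately have "card A = t - (Suc b - a)"
      using le by (simp add: card_Diff_subset)
    then have "int (card A) = int t - (int b - int a + 1)"
      using le \<open>b \<in> {1..t}\<close> \<open>a \<in> {1..t}\<close> by auto
    then show ?thesis
      using le \<open>b \<in> {1..t}\<close> \<open>a \<in> {1..t}\<close>
      by (intro lift[where f = "\<lambda>i. if b < i then int i else int i + int t" and s = "int b + 1"])
         (auto simp: A_eq)
  qed
qed

text \<open>Each interval from \<open>h x\<close> to \<open>h x + w x\<close> shares a point
  \<open>z\<close> with the next one. Going from \<open>a\<close> to \<open>z\<close> costs at most
  \<open>w x\<close>, and \<open>z\<close> takes the role of \<open>a\<close> for the rest of the
  list.\<close>

lemma chained_intervals_bound:
  fixes h w :: "'a \<Rightarrow> int"
  assumes "successively (\<lambda>x y. \<exists>z. h x \<le> z \<and> z \<le> h x + w x \<and> h y \<le> z \<and> z \<le> h y + w y) p"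
    and "p \<noteq> []" "h (hd p) \<le> a" "b \<le> h (last p) + w (last p)"
  shows "b - a \<le> sum_list (map w p)"
  using assms
proof (induction p arbitrary: a)
  case Nil
  then show ?case by simp
next
  case (Cons x p)
  show ?case
  proof (cases "p = []")
    case True
    then show ?thesis using Cons.prems by simp
  next
    case False
    then obtain z where z: "z \<le> h x + w x" "h (hd p) \<le> z"
      using Cons.prems(1) by (auto simp: successively_Cons)
    have "b - z \<le> sum_list (map w p)"
      using Cons.IH[of z] Cons.prems False z by (auto simp: successively_Cons)
    then show ?thesis using z Cons.prems(3) by simp
  qed
qed

text \<open>The values of \<open>L\<close> are distinct integers between their minimum
  \<open>L v\<close> and their maximum \<open>L w\<close>.\<close>

lemma card_inj_int_bound:
  fixes L :: "'a \<Rightarrow> int"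
  assumes fin: "finite F" and ne: "F \<noteq> {}" and inj: "inj_on L F"
  obtains v w where "v \<in> F" "w \<in> F" "int (card F) \<le> L w - L v + 1"
proof -
  have fin': "finite (L ` F)" and ne': "L ` F \<noteq> {}" using fin ne by auto
  obtain v w where v: "v \<in> F" "L v = Min (L ` F)" and w: "w \<in> F" "L w = Max (L ` F)"
    using Min_in[OF fin' ne'] Max_in[OF fin' ne'] by (metis imageE)
  have "L ` F \<subseteq> {L v..L w}" using v w fin' by auto
  then have "card F \<le> nat (L w - L v + 1)"
    using card_mono[of "{L v..L w}" "L ` F"] card_image[OF inj] by simp
  moreover have "L v \<le> L w" using v w fin' ne' by (metis Max_ge Min_in)
  ultimately show ?thesis using that[OF v(1) w(1)] by linarith
qed

section \<open>The graph \<open>tilde T\<close> with pendant edges\<close>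

lemma simple_graph_tilde:
  assumes "simple_graph T"
  shows "simple_graph (tilde T)"
  using assms by (fastforce simp: simple_graph_def tilde_def leaves_def card_image)

text \<open>The edges at the copy of \<open>x\<close> come from \<open>T\<close>, from the added
  vertex if \<open>x\<close> is a leaf, or are pendant. Their number bounds the number of colours at
  \<open>x\<close>, and with it the length of the lifted interval.\<close>

lemma card_incident_attach_tilde:
  assumes T: "simple_graph T" and x: "x \<in> verts T"
  shows "finite (incident (attach_pendant (tilde T) p) (Inl (Some x)))"
    and "card (incident (attach_pendant (tilde T) p) (Inl (Some x)))
      \<le> vertex_degree T x + of_bool (x \<in> leaves T) + p (Some x)"
proof -
  let ?I = "incident (attach_pendant (tilde T) p) (Inl (Some x))"
  let ?A = "(\<lambda>e. Inl ` Some ` e) ` incident T x :: ('a option + 'a option \<times> nat) set set"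
  let ?B = "if x \<in> leaves T then {{Inl None, Inl (Some x)}} else {} :: ('a option + 'a option \<times> nat) set set"
  let ?C = "(\<lambda>i. {Inl (Some x), Inr (Some x, i)}) ` {..<p (Some x)}"
  have fin: "finite (incident T x)"
    using simple_graph_finite_edges[OF T] by (simp add: incident_def)
  have sub: "?I \<subseteq> ?A \<union> ?B \<union> ?C"
    by (auto simp: incident_def attach_pendant_def tilde_def)
  have fin': "finite (?A \<union> ?B \<union> ?C)" using fin by auto
  show "finite ?I" using sub fin' by (rule finite_subset)
  have "card ?I \<le> card (?A \<union> ?B \<union> ?C)" using fin' sub by (rule card_mono)
  also have "\<dots> \<le> card ?A + card ?B + card ?C"
    by (meson add_right_mono card_Un_le order_trans)
  also have "\<dots> \<le> vertex_degree T x + of_bool (x \<in> leaves T) + p (Some x)"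
    using card_image_le[OF fin, of "\<lambda>e. Inl ` Some ` e :: ('a option + 'a option \<times> nat) set"]
      card_image_le[of "{..<p (Some x)}" "\<lambda>i. {Inl (Some x), Inr (Some x, i)} :: ('a option + 'a option \<times> nat) set"]
    by (auto simp: vertex_degree_def)
  finally show "card ?I \<le> vertex_degree T x + of_bool (x \<in> leaves T) + p (Some x)" .
qed

section \<open>From a colouring to the bound\<close>

lemma colorable_attach_tilde_bound:
  assumes T: "tree T" and col: "cyclic_interval_coloring (attach_pendant (tilde T) p) t c"
  shows "card (leaves T) \<le> max_LP T + 2 + (\<Sum>v\<in>verts (tilde T). p v)"
proof (cases "card (leaves T) \<le> 1")
  case True
  then show ?thesis by simp
next
  case False
  let ?G = "attach_pendant (tilde T) p"
  let ?I = "\<lambda>x. incident ?G (Inl (Some x))"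
  have simple: "simple_graph T" by (rule tree_simple[OF T])
  then have finV: "finite (verts T)" by (simp add: simple_graph_def)
  define E where "E x y = {Inl (Some x), Inl (Some y) :: 'a option + 'a option \<times> nat}" for x y
  define N where "N x = {Inl None, Inl (Some x) :: 'a option + 'a option \<times> nat}" for x
  \<comment> \<open>An interval of \<open>n\<close> integers has width \<open>n - 1\<close>;
    \<open>W x\<close> is this width for the bound on the number of edges at
    \<open>x\<close>.\<close>
  define W where "W x = int (vertex_degree T x) + of_bool (x \<in> leaves T) + int (p (Some x)) - 1" for x
  have E_sym: "E y x = E x y" for x y by (auto simp: E_def)
  have E_in: "E x y \<in> ?I x" if "{x, y} \<in> edges T" for x y
  proof -
    have "Inl ` Some ` {x, y} \<in> edges ?G"
      unfolding attach_pendant_def tilde_def graph.sel by (intro UnI1 imageI that)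
    then show ?thesis by (simp add: E_def incident_def)
  qed
  have N_in: "N x \<in> ?I x" "N x \<in> edges ?G" if "x \<in> leaves T" for x
  proof -
    have "{None, Some x} \<in> edges (tilde T)" using that by (auto simp: tilde_def)
    then have "Inl ` {None, Some x} \<in> edges ?G"
      unfolding attach_pendant_def graph.sel by (intro UnI1 imageI)
    then show "N x \<in> edges ?G" by (simp add: N_def)
    then show "N x \<in> ?I x" by (auto simp: incident_def N_def)
  qed
  have "\<exists>s f. \<forall>e\<in>?I x. int t dvd f (c e) - int (c e) \<and> s \<le> f (c e) \<and> f (c e) \<le> s + W x"
    if x: "x \<in> verts T" for x
  proof -
    have "Inl (Some x) \<in> verts ?G" using x by (auto simp: attach_pendant_def tilde_def)
    then have "cyclic_interval t (c ` ?I x)"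
      using col by (simp add: cyclic_interval_coloring_def)
    then obtain s f where f: "\<And>a. a \<in> c ` ?I x \<Longrightarrow> int t dvd f a - int a"
      "\<And>a. a \<in> c ` ?I x \<Longrightarrow> s \<le> f a" "\<And>a. a \<in> c ` ?I x \<Longrightarrow> f a < s + int (card (c ` ?I x))"
      by (rule cyclic_interval_lift) blast
    note card_I = card_incident_attach_tilde[OF simple x, of p]
    have "card (c ` ?I x) \<le> vertex_degree T x + of_bool (x \<in> leaves T) + p (Some x)"
      using card_image_le[OF card_I(1), of c] card_I(2) by (rule order_trans)
    then have "int (card (c ` ?I x)) \<le> W x + 1"
      unfolding W_def of_bool_def by (auto split: if_splits)
    then have "f (c e) \<le> s + W x" if "e \<in> ?I x" for e
      using f(3)[of "c e"] that by auto
    then show ?thesis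
      using f(1,2) by (intro exI[of _ s] exI[of _ f] ballI conjI) simp_all
  qed
  then obtain s f where
    f_dvd: "\<And>x e. x \<in> verts T \<Longrightarrow> e \<in> ?I x \<Longrightarrow> int t dvd f x (c e) - int (c e)" and
    f_lower: "\<And>x e. x \<in> verts T \<Longrightarrow> e \<in> ?I x \<Longrightarrow> s x \<le> f x (c e)" and
    f_upper: "\<And>x e. x \<in> verts T \<Longrightarrow> e \<in> ?I x \<Longrightarrow> f x (c e) \<le> s x + W x"
    by metis
  \<comment> \<open>The lifts chosen at \<open>x\<close> and at \<open>y\<close> for the colour of
    their common edge differ by \<open>g x y\<close> full turns.\<close>
  define g where "g x y = (f x (c (E x y)) - f y (c (E x y))) div int t" for x y
  have g: "f x (c (E x y)) - f y (c (E x y)) = int t * g x y"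
    if e: "{x, y} \<in> edges T" for x y
  proof -
    have e': "{y, x} \<in> edges T" using e by (simp add: insert_commute)
    note xy = simple_graph_edgeD[OF simple e]
    have "int t dvd (f x (c (E x y)) - int (c (E x y))) - (f y (c (E x y)) - int (c (E x y)))"
      using f_dvd[OF xy(1) E_in[OF e]] f_dvd[OF xy(2) E_in[OF e']]
      unfolding E_sym[of x y] by (rule dvd_diff)
    then show ?thesis by (simp add: g_def)
  qed
  \<comment> \<open>Positivity allows \<open>t\<close> to be cancelled in the proof that
    \<open>g\<close> is antisymmetric.\<close>
  have tpos: "t > 0"
  proof -
    obtain v where "v \<in> leaves T" using False by fastforce
    then have "c (N v) \<in> {1..t}"
      using N_in(2) col by (auto simp: cyclic_interval_coloring_def proper_edge_coloring_def)
    then show ?thesis by simp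
  qed
  have "g y x = - g x y" if e: "{x, y} \<in> edges T" for x y
  proof -
    have "int t * g y x = int t * - g x y"
      using g[OF e] g[of y x] e by (simp add: insert_commute E_sym[of x y])
    then show ?thesis using tpos by (simp only: mult_cancel_left) auto
  qed
  \<comment> \<open>Raising the lift at every \<open>x\<close> by \<open>t\<close> times
    \<open>k x\<close> makes the two lifts of each tree edge agree.\<close>
  then obtain k where k: "\<And>x y. {x, y} \<in> edges T \<Longrightarrow> k y - k x = g x y"
    using tree_potential[OF T, where w = g] by metis
  \<comment> \<open>\<open>h x\<close> is the lower end of the shifted interval at \<open>x\<close>,
    and \<open>L v\<close> is the shifted lift of the edge from the leaf \<open>v\<close> to the
    added vertex.\<close>
  define h where "h x = s x + int t * k x" for x
  define L where "L v = f v (c (N v)) + int t * k v" for v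
  have leaf_vert: "v \<in> verts T" if "v \<in> leaves T" for v using that by (simp add: leaves_def)
  have L_lower: "h v \<le> L v" and L_upper: "L v \<le> h v + W v" if "v \<in> leaves T" for v
    using f_lower[OF leaf_vert N_in(1)] f_upper[OF leaf_vert N_in(1)] that
    by (auto simp: h_def L_def)
  \<comment> \<open>\<open>L x\<close> is congruent to the colour of \<open>N x\<close> modulo
    \<open>t\<close>, and colours in \<open>{1..t}\<close> are determined by their residue. All
    edges \<open>N x\<close> meet in the added vertex, so properness separates them.\<close>
  have "inj_on L (leaves T)"
  proof (rule inj_onI)
    fix v w assume v: "v \<in> leaves T" and w: "w \<in> leaves T" and eq: "L v = L w"
    have mod: "int t dvd L x - int (c (N x))" if "x \<in> leaves T" for x
      using f_dvd[OF leaf_vert N_in(1)] that by (simp add: L_def algebra_simps)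
        (metis add_diff_eq dvd_add dvd_triv_left)
    have "int t dvd int (c (N w)) - int (c (N v))"
      using dvd_diff[OF mod[OF v] mod[OF w]] eq by simp
    moreover have range: "c (N x) \<in> {1..t}" if "x \<in> leaves T" for x
      using N_in(2)[OF that] col by (auto simp: cyclic_interval_coloring_def proper_edge_coloring_def)
    have "\<bar>int (c (N w)) - int (c (N v))\<bar> < int t"
      using range[OF v] range[OF w] by auto
    ultimately have "c (N w) = c (N v)"
      by (metis dvd_imp_le_int abs_of_nat eq_iff_diff_eq_0 linorder_not_less of_nat_eq_iff)
    moreover have "N w \<inter> N v \<noteq> {}" by (simp add: N_def)
    ultimately have "N w = N v"
      using N_in(2)[OF v] N_in(2)[OF w] col
      unfolding cyclic_interval_coloring_def proper_edge_coloring_def by metis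
    then show "v = w" by (auto simp: N_def doubleton_eq_iff)
  qed
  moreover have "finite (leaves T)" using finV by (simp add: leaves_def)
  moreover have "leaves T \<noteq> {}" using False by force
  ultimately obtain v w where v: "v \<in> leaves T" and w: "w \<in> leaves T"
    and F: "int (card (leaves T)) \<le> L w - L v + 1"
    by (metis card_inj_int_bound)
  \<comment> \<open>\<open>max_LP\<close> ranges over pairs of distinct vertices; by
    \<open>F\<close>, equal ends would leave at most one leaf.\<close>
  have vw: "v \<noteq> w" using F False by auto
  let ?p = "tree_path T v w" and ?S = "VP T v w"
  have path: "is_path T ?p" "hd ?p = v" "last ?p = w"
    using tree_path_between[OF T leaf_vert leaf_vert] v w by (auto simp: path_between_def)
  \<comment> \<open>The common lift of the edge between \<open>x\<close> and \<open>y\<close> lies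
    in the shifted intervals of both ends.\<close>
  have "successively (\<lambda>x y. \<exists>z. h x \<le> z \<and> z \<le> h x + W x \<and> h y \<le> z \<and> z \<le> h y + W y) ?p"
  proof (rule successively_mono[where P = "\<lambda>x y. {x, y} \<in> edges T"])
    show "successively (\<lambda>x y. {x, y} \<in> edges T) ?p" using path by (simp add: is_path_def)
  next
    fix x y assume e: "{x, y} \<in> edges T"
    then have e': "{y, x} \<in> edges T" by (simp add: insert_commute)
    note xy = simple_graph_edgeD[OF simple e]
    let ?z = "f x (c (E x y)) + int t * k x"
    have "?z = f y (c (E y x)) + int t * k y"
      using g[OF e] k[OF e] E_sym[of x y] by (simp add: algebra_simps)
    then show "\<exists>z. h x \<le> z \<and> z \<le> h x + W x \<and> h y \<le> z \<and> z \<le> h y + W y"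
      using f_lower[OF xy(1) E_in[OF e]] f_upper[OF xy(1) E_in[OF e]]
        f_lower[OF xy(2) E_in[OF e']] f_upper[OF xy(2) E_in[OF e']]
      by (intro exI[of _ ?z]) (auto simp: h_def)
  qed
  then have "L w - L v \<le> sum_list (map W ?p)"
    by (rule chained_intervals_bound) (use path L_lower[OF v] L_upper[OF w] in \<open>auto simp: is_path_def\<close>)
  also have "\<dots> = (\<Sum>x\<in>?S. W x)"
    using path by (simp add: VP_def is_path_def sum_list_distinct_conv_sum_set)
  also have "\<dots> = int (\<Sum>x\<in>?S. vertex_degree T x) + int (card (?S \<inter> leaves T))
      + int (\<Sum>x\<in>?S. p (Some x)) - int (card ?S)"
    by (simp add: W_def sum.distrib sum_subtractf VP_def)
  finally have walk: "L w - L v \<le> \<dots>" .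
  have "?S \<inter> leaves T \<subseteq> {v, w}"
    using leaf_in_path[OF path(1)] path by (auto simp: VP_def)
  then have "card (?S \<inter> leaves T) \<le> card {v, w}" by (intro card_mono) auto
  also have "\<dots> \<le> 2" by (simp add: card_insert_if)
  finally have ends: "card (?S \<inter> leaves T) \<le> 2" .
  have "(\<Sum>x\<in>?S. p (Some x)) = (\<Sum>y\<in>Some ` ?S. p y)"
    by (simp add: sum.reindex)
  also have "\<dots> \<le> (\<Sum>y\<in>verts (tilde T). p y)"
    using path finV by (intro sum_mono2) (auto simp: tilde_def VP_def is_path_def)
  finally have pendant: "(\<Sum>x\<in>?S. p (Some x)) \<le> (\<Sum>y\<in>verts (tilde T). p y)" .
  have "{LP T x y | x y. x \<in> verts T \<and> y \<in> verts T \<and> x \<noteq> y}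
      \<subseteq> (\<lambda>(x, y). LP T x y) ` (verts T \<times> verts T)" by auto
  then have "finite {LP T x y | x y. x \<in> verts T \<and> y \<in> verts T \<and> x \<noteq> y}"
    by (rule finite_subset) (simp add: finV)
  moreover have "LP T v w \<in> {LP T x y | x y. x \<in> verts T \<and> y \<in> verts T \<and> x \<noteq> y}"
    using leaf_vert[OF v] leaf_vert[OF w] vw by blast
  ultimately have "LP T v w \<le> max_LP T"
    unfolding max_LP_def by (rule Max_ge)
  \<comment> \<open>The degrees less one contribute at most \<open>LP T v w - 1\<close>, the two
    leaf ends at most 2, and passing from a difference to a count of integers adds 1; this yields
    the constant 2.\<close>
  then show ?thesis
    using F walk ends pendant sum_degree_VP[OF T leaf_vert[OF v] leaf_vert[OF w]] by linarith
qed

theorem theorem10: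
  fixes T :: "'a graph"
  assumes "tree T" and "card (verts T) \<ge> 2"
  shows "int (cyclic_deficiency (tilde T)) \<ge> int (card (leaves T)) - int (max_LP T) - 2"
proof -
  \<comment> \<open>Existence of some colourable attachment ensures that the \<open>LEAST\<close> in
    the deficiency is attained.\<close>
  have "\<exists>k p. (\<Sum>v\<in>verts (tilde T). p v) = k
      \<and> cyclically_interval_colorable (attach_pendant (tilde T) p)"
    using attach_pendant_colorable_exists[OF simple_graph_tilde[OF tree_simple[OF assms(1)]]]
    by blast
  then obtain p where p: "(\<Sum>v\<in>verts (tilde T). p v) = cyclic_deficiency (tilde T)"
    and "cyclically_interval_colorable (attach_pendant (tilde T) p)"
    unfolding cyclic_deficiency_def by (rule LeastI_ex[THEN exE]) blast
  then obtain t c where "cyclic_interval_coloring (attach_pendant (tilde T) p) t c"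
    by (auto simp: cyclically_interval_colorable_def)
  from colorable_attach_tilde_bound[OF assms(1) this] show ?thesis
    unfolding p by linarith
qed

end
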